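(* Let $\Omega\subset\mathbb{R}^2$ be an open set that is star-shaped with respect to the origin $O=(0,0)\in\Omega$ (for instance a strip $(a,b)\times\mathbb{R}$ with $a<0<b$). Let $\phi\in C^1(\Omega,\mathbb{R})$ be such that $x\phi_x+y\phi_y$ does not change sign in $\Omega$, and such that the set $\{(x,y)\in\Omega : x\phi_x(x,y)+y\phi_y(x,y)=0\}$ does not contain any non-trivial positive semi-orbit of the system $$\dot x=y,\qquad \dot y=-x-y\,\phi(x,y).$$ Then this system has at most one limit cycle in $\Omega$, and if such a limit cycle exists it is hyperbolic.
   Context: Subscripts denote partial derivatives. A function "does not change sign" if it is everywhere $\ge 0$ or everywhere $\le 0$. A semi-orbit is non-trivial if it is not an equilibrium point. A cycle is the orbit of a non-constant periodic solution; a limit cycle is an isolated cycle. A $T$-periodic cycle $\gamma(t)$ of a planar system $\dot x=P(x,y)$, $\dot y=Q(x,y)$ is hyperbolic if $\int_0^T \left(\frac{\partial P}{\partial x}+\frac{\partial Q}{\partial y}\right)(\gamma(t))\,dt\neq 0$. *)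

theory Defs
  imports "HOL-Analysis.Analysis"
begin

definition partial_x :: "(real \<times> real \<Rightarrow> real) \<Rightarrow> real \<times> real \<Rightarrow> real" where
  "partial_x f p = deriv (\<lambda>s. f (s, snd p)) (fst p)"

definition partial_y :: "(real \<times> real \<Rightarrow> real) \<Rightarrow> real \<times> real \<Rightarrow> real" where
  "partial_y f p = deriv (\<lambda>s. f (fst p, s)) (snd p)"

definition C1_on :: "(real \<times> real \<Rightarrow> real) \<Rightarrow> (real \<times> real) set \<Rightarrow> bool" where
  "C1_on f \<Omega> \<longleftrightarrow>
     (\<forall>(x, y) \<in> \<Omega>. (\<lambda>s. f (s, y)) differentiable (at x) \<and> (\<lambda>s. f (x, s)) differentiable (at y)) \<and>
     continuous_on \<Omega> (partial_x f) \<and> continuous_on \<Omega> (partial_y f)"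

definition does_not_change_sign_on :: "(real \<times> real \<Rightarrow> real) \<Rightarrow> (real \<times> real) set \<Rightarrow> bool" where
  "does_not_change_sign_on f \<Omega> \<longleftrightarrow> (\<forall>p\<in>\<Omega>. f p \<ge> 0) \<or> (\<forall>p\<in>\<Omega>. f p \<le> 0)"

text \<open>In what follows \<open>P\<close>, \<open>Q\<close> and \<open>\<Omega>\<close> stand for the planar system
  \<open>x' = P (x, y)\<close>, \<open>y' = Q (x, y)\<close> with phase space \<open>\<Omega>\<close>.\<close>

definition solution_on ::
  "(real \<times> real \<Rightarrow> real) \<Rightarrow> (real \<times> real \<Rightarrow> real) \<Rightarrow> (real \<times> real) set \<Rightarrow>
   real set \<Rightarrow> (real \<Rightarrow> real \<times> real) \<Rightarrow> bool" where
  "solution_on P Q \<Omega> J \<gamma> \<longleftrightarrow>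
     (\<forall>t\<in>J. \<gamma> t \<in> \<Omega> \<and> (\<gamma> has_vector_derivative (P (\<gamma> t), Q (\<gamma> t))) (at t within J))"

text \<open>A solution may leave \<open>\<Omega>\<close> or blow up in finite time, so a positive semi-orbit is
  the image of a solution that starts at time 0 and cannot be continued further to the right.\<close>

definition positive_semi_orbit ::
  "(real \<times> real \<Rightarrow> real) \<Rightarrow> (real \<times> real \<Rightarrow> real) \<Rightarrow> (real \<times> real) set \<Rightarrow>
   (real \<times> real) set \<Rightarrow> bool" where
  "positive_semi_orbit P Q \<Omega> S \<longleftrightarrow>
     (\<exists>J \<gamma>. is_interval J \<and> 0 \<in> J \<and> J \<subseteq> {0..} \<and> solution_on P Q \<Omega> J \<gamma> \<and> S = \<gamma> ` J \<and>
        (\<forall>J' \<gamma>'. is_interval J' \<and> J \<subseteq> J' \<and> J' \<subseteq> {0..} \<and> solution_on P Q \<Omega> J' \<gamma>' \<and>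
           (\<forall>t\<in>J. \<gamma>' t = \<gamma> t) \<longrightarrow> J' = J))"

definition equilibrium ::
  "(real \<times> real \<Rightarrow> real) \<Rightarrow> (real \<times> real \<Rightarrow> real) \<Rightarrow> (real \<times> real) set \<Rightarrow> real \<times> real \<Rightarrow> bool" where
  "equilibrium P Q \<Omega> p \<longleftrightarrow> p \<in> \<Omega> \<and> P p = 0 \<and> Q p = 0"

definition nontrivial_positive_semi_orbit ::
  "(real \<times> real \<Rightarrow> real) \<Rightarrow> (real \<times> real \<Rightarrow> real) \<Rightarrow> (real \<times> real) set \<Rightarrow>
   (real \<times> real) set \<Rightarrow> bool" where
  "nontrivial_positive_semi_orbit P Q \<Omega> S \<longleftrightarrow>
     positive_semi_orbit P Q \<Omega> S \<and> \<not> (\<exists>p. equilibrium P Q \<Omega> p \<and> S = {p})"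

definition periodic_solution ::
  "(real \<times> real \<Rightarrow> real) \<Rightarrow> (real \<times> real \<Rightarrow> real) \<Rightarrow> (real \<times> real) set \<Rightarrow>
   real \<Rightarrow> (real \<Rightarrow> real \<times> real) \<Rightarrow> bool" where
  "periodic_solution P Q \<Omega> T \<gamma> \<longleftrightarrow>
     T > 0 \<and> solution_on P Q \<Omega> UNIV \<gamma> \<and> (\<forall>t. \<gamma> (t + T) = \<gamma> t)"

definition cycle ::
  "(real \<times> real \<Rightarrow> real) \<Rightarrow> (real \<times> real \<Rightarrow> real) \<Rightarrow> (real \<times> real) set \<Rightarrow>
   (real \<times> real) set \<Rightarrow> bool" where
  "cycle P Q \<Omega> C \<longleftrightarrow>
     (\<exists>T \<gamma>. periodic_solution P Q \<Omega> T \<gamma> \<and> \<not> \<gamma> constant_on UNIV \<and> C = range \<gamma>)"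

definition limit_cycle ::
  "(real \<times> real \<Rightarrow> real) \<Rightarrow> (real \<times> real \<Rightarrow> real) \<Rightarrow> (real \<times> real) set \<Rightarrow>
   (real \<times> real) set \<Rightarrow> bool" where
  "limit_cycle P Q \<Omega> C \<longleftrightarrow>
     cycle P Q \<Omega> C \<and>
     (\<exists>U. open U \<and> C \<subseteq> U \<and> (\<forall>C'. cycle P Q \<Omega> C' \<and> C' \<subseteq> U \<longrightarrow> C' = C))"

text \<open>\<open>T\<close> need not be the minimal period: passing to a multiple of the period, or to a
  time translate of the solution, does not affect whether the integral vanishes.\<close>

definition hyperbolic_cycle ::
  "(real \<times> real \<Rightarrow> real) \<Rightarrow> (real \<times> real \<Rightarrow> real) \<Rightarrow> (real \<times> real) set \<Rightarrow>
   (real \<times> real) set \<Rightarrow> bool" where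
  "hyperbolic_cycle P Q \<Omega> C \<longleftrightarrow>
     cycle P Q \<Omega> C \<and>
     (\<forall>T \<gamma>. periodic_solution P Q \<Omega> T \<gamma> \<and> range \<gamma> = C \<longrightarrow>
        integral {0..T} (\<lambda>t. partial_x P (\<gamma> t) + partial_y Q (\<gamma> t)) \<noteq> 0)"

end

theory Submission
  imports Defs
begin

text \<open>Write \<open>\<nu> = x \<phi>\<^sub>x + y \<phi>\<^sub>y\<close>. Along a solution, \<open>W = x\<^sup>2 + y\<^sup>2 + x y \<phi>\<close> (that is,
  \<open>r\<^sup>2\<close> times the clockwise angular speed) satisfies \<open>W' = D W + y\<^sup>2 \<nu>\<close>, where \<open>D\<close> is the divergence
  of the vector field. On a cycle \<open>W\<close> is positive where \<open>y = 0\<close>; since \<open>\<nu>\<close> has constant sign, an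
  integrating factor propagates this around the period, so that every cycle is a polar graph.
  Hyperbolicity follows because \<open>ln W\<close> is periodic, whence \<open>\<integral> D = - \<integral> y\<^sup>2 \<nu> / W\<close>, and the right-hand
  side vanishes only if \<open>\<nu> = 0\<close> on the whole cycle.

  For uniqueness, compare two cycles \<open>r = \<rho>\<^sub>1(\<theta>)\<close>, \<open>r = \<rho>\<^sub>2(\<theta>)\<close> (clockwise angle) through
  \<open>u = ln (\<rho>\<^sub>2 / \<rho>\<^sub>1)\<close>. The equation for \<open>\<rho>\<close> gives
  \<open>u' = - sin\<^sup>2 \<theta> (\<phi>\<^sub>2 - \<phi>\<^sub>1) / (w\<^sub>1 w\<^sub>2)\<close> with \<open>w\<^sub>i = 1 - sin \<theta> cos \<theta> \<phi>\<^sub>i > 0\<close>. As \<open>\<phi>\<close> is monotone along rays,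
  \<open>u\<^sup>2\<close> is monotone; being periodic it is constant. Either \<open>u = 0\<close> and the cycles coincide, or
  \<open>\<phi>\<^sub>1 = \<phi>\<^sub>2\<close> throughout, which forces \<open>\<nu> = 0\<close> on the inner cycle.\<close>

section \<open>Preliminaries: antiderivatives, periodic functions, differentiation in the
  plane\<close>

text \<open>Provides the exponent of the integrating factor in \<open>W_pos\<close> and the angle in
  \<open>polar_graph\<close>; both must be defined for all real times.\<close>

lemma continuous_antiderivative_UNIV:
  fixes f :: "real \<Rightarrow> real"
  assumes "continuous_on UNIV f"
  obtains F where "\<And>x. (F has_real_derivative f x) (at x)"
proof -
  have "\<exists>F. \<forall>x::real. -\<infinity> < ereal x \<longrightarrow> ereal x < \<infinity> \<longrightarrow> (F has_vector_derivative f x) (at x)"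
    using assms by (intro einterval_antiderivative) (auto simp: continuous_on_eq_continuous_at)
  then show thesis
    using that by (auto simp: has_real_derivative_iff_has_vector_derivative)
qed

lemma periodic_add_of_nat_mult:
  fixes f :: "real \<Rightarrow> 'a"
  assumes "\<And>t. f (t + T) = f t"
  shows "f (t + of_nat n * T) = f t"
proof (induction n)
  case (Suc n)
  have "t + of_nat (Suc n) * T = (t + of_nat n * T) + T"
    by (simp add: algebra_simps)
  then show ?case
    using Suc assms by metis
qed simp

lemma periodic_representative:
  fixes f :: "real \<Rightarrow> 'a"
  assumes per: "\<And>t. f (t + T) = f t" and "T > 0"
  obtains s where "a \<le> s" "s < a + T" "f s = f t"
proof -
  define k where "k = \<lfloor>(t - a) / T\<rfloor>"
  have "of_int k \<le> (t - a) / T" "(t - a) / T < of_int k + 1"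
    unfolding k_def by linarith+
  then have k: "of_int k * T \<le> t - a" "t - a < (of_int k + 1) * T"
    using \<open>T > 0\<close> by (simp_all add: field_simps)
  define s where "s = t - of_int k * T"
  have "f s = f t"
  \<comment> \<open>Shifts are available only by natural multiples of \<open>T\<close>, so for
    negative \<open>k\<close> the forward shift leads from \<open>t\<close> to \<open>s\<close>
    instead.\<close>
  proof (cases "k \<ge> 0")
    case True
    then have "t = s + of_nat (nat k) * T" by (simp add: s_def)
    then show ?thesis using periodic_add_of_nat_mult[of f T s "nat k", OF per] by simp
  next
    case False
    then have "s = t + of_nat (nat (- k)) * T" by (simp add: s_def)
    then show ?thesis using periodic_add_of_nat_mult[of f T t "nat (- k)", OF per] by simp
  qed
  moreover have "a \<le> s" "s < a + T"
    using k by (simp_all add: s_def algebra_simps)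
  ultimately show thesis using that by blast
qed

text \<open>The representative of \<open>t\<close> in \<open>[s, s + T)\<close> lies to the right of
  \<open>s\<close>, so \<open>f s \<le> f t\<close> for every pair; exchanging the two arguments
  gives equality.\<close>

lemma mono_periodic_imp_constant:
  fixes f :: "real \<Rightarrow> real"
  assumes "T > 0" "\<And>t. f (t + T) = f t" "\<And>s t. s \<le> t \<Longrightarrow> f s \<le> f t"
  shows "f s = f t"
proof -
  have "f s \<le> f t" for s t
    using periodic_representative[of f T s t] assms by metis
  then show ?thesis by (simp add: order_antisym)
qed

text \<open>\<open>C1_on\<close> speaks of one variable at a time. Continuity of the partial
  derivative in the second variable upgrades this to a total derivative, which the chain rule along
  solutions and rays requires.\<close>

lemma C1_on_has_derivative:
  fixes f :: "real \<times> real \<Rightarrow> real"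
  assumes "open \<Omega>" "C1_on f \<Omega>" "p \<in> \<Omega>"
  shows "(f has_derivative (\<lambda>h. fst h * partial_x f p + snd h * partial_y f p)) (at p)"
proof -
  obtain a b where p: "p = (a, b)" by (cases p)
  obtain A B where AB: "open A" "open B" "p \<in> A \<times> B" "A \<times> B \<subseteq> \<Omega>"
    using open_prod_elim assms by metis
  \<comment> \<open>The second factor is shrunk to a ball because
    \<open>has_derivative_partialsI\<close> wants it convex.\<close>
  obtain e where e: "e > 0" "ball b e \<subseteq> B"
    using AB p by (metis mem_Sigma_iff openE)
  have sub: "A \<times> ball b e \<subseteq> \<Omega>" using AB e by auto
  have diff: "(\<lambda>s. f (s, y)) differentiable (at x)" "(\<lambda>s. f (x, s)) differentiable (at y)"
    if "(x, y) \<in> \<Omega>" for x y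
    using assms(2) that unfolding C1_on_def by auto
  have Dx: "((\<lambda>s. f (s, y)) has_real_derivative partial_x f (x, y)) (at x)"
    and Dy: "((\<lambda>s. f (x, s)) has_real_derivative partial_y f (x, y)) (at y)"
    if "(x, y) \<in> \<Omega>" for x y
    using diff[OF that]
    by (auto simp: partial_x_def partial_y_def DERIV_deriv_iff_real_differentiable)
  have "continuous_on \<Omega> (\<lambda>p. blinfun_scaleR_left (partial_y f p))"
    using assms(2) unfolding C1_on_def
    by (auto intro!: bounded_linear.continuous_on[OF bounded_linear_blinfun_scaleR_left])
  then have cont: "continuous (at (a, b) within A \<times> ball b e) (\<lambda>p. blinfun_scaleR_left (partial_y f p))"
    using sub p AB e by (metis SigmaI SigmaD1 centre_in_ball continuous_on_eq_continuous_within continuous_on_subset)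
  have "((\<lambda>(x, y). f (x, y)) has_derivative
      (\<lambda>(tx, ty). tx * partial_x f (a, b) + blinfun_scaleR_left (partial_y f (a, b)) ty))
      (at (a, b) within A \<times> ball b e)"
  proof (rule has_derivative_partialsI[where fx = "\<lambda>h. h * partial_x f (a, b)"
        and fy = "\<lambda>x y. blinfun_scaleR_left (partial_y f (x, y))"])
    show "((\<lambda>x. f (x, b)) has_derivative (\<lambda>h. h * partial_x f (a, b))) (at a within A)"
      using Dx[of a b] assms(3) p
      by (auto simp: has_field_derivative_def mult_commute_abs intro: has_derivative_at_withinI)
    show "((\<lambda>y. f (x, y)) has_derivative blinfun_scaleR_left (partial_y f (x, y))) (at y within ball b e)"
      if "x \<in> A" "y \<in> ball b e" for x y
    proof -
      have "(x, y) \<in> \<Omega>" using that sub by auto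
      from Dy[OF this] show ?thesis
        by (auto simp: has_field_derivative_def mult_commute_abs intro: has_derivative_at_withinI)
    qed
    show "continuous (at (a, b) within A \<times> ball b e)
       (\<lambda>(x, y). blinfun_scaleR_left (partial_y f (x, y)))"
      using cont by (simp add: case_prod_unfold)
  qed (use e in auto)
  moreover have "at (a, b) within A \<times> ball b e = at (a, b)"
    using AB e p by (intro at_within_open) (auto intro: open_Times)
  ultimately show ?thesis
    by (simp add: p case_prod_unfold)
qed

lemma C1_on_chain:
  fixes f :: "real \<times> real \<Rightarrow> real" and g :: "real \<Rightarrow> real \<times> real"
  assumes "open \<Omega>" "C1_on f \<Omega>" "g t \<in> \<Omega>" "(g has_vector_derivative (a, b)) (at t)"
  shows "((\<lambda>t. f (g t)) has_real_derivative a * partial_x f (g t) + b * partial_y f (g t)) (at t)"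
proof -
  have "((\<lambda>t. f (g t)) has_derivative
      (\<lambda>h. fst (h *\<^sub>R (a, b)) * partial_x f (g t) + snd (h *\<^sub>R (a, b)) * partial_y f (g t))) (at t)"
    using assms(4) C1_on_has_derivative[OF assms(1-3)]
    unfolding has_vector_derivative_def by (rule has_derivative_compose)
  then show ?thesis
    unfolding has_field_derivative_def
    by (rule has_derivative_eq_rhs) (simp add: fun_eq_iff algebra_simps)
qed

text \<open>The sign \<open>\<sigma>\<close> treats \<open>\<nu> \<ge> 0\<close> and \<open>\<nu> \<le> 0\<close> at the same time.\<close>

locale radially_monotone =
  fixes \<Omega> :: "(real \<times> real) set" and \<phi> :: "real \<times> real \<Rightarrow> real" and \<sigma> :: real
  assumes open_domain: "open \<Omega>"
    and star: "p \<in> \<Omega> \<Longrightarrow> closed_segment (0, 0) p \<subseteq> \<Omega>"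
    and C1: "C1_on \<phi> \<Omega>"
    and sign_cases: "\<sigma> = 1 \<or> \<sigma> = - 1"
    and radial_sign: "p \<in> \<Omega> \<Longrightarrow> 0 \<le> \<sigma> * (fst p * partial_x \<phi> p + snd p * partial_y \<phi> p)"
begin

section \<open>Behaviour of \<open>\<phi>\<close> along rays from the origin\<close>

definition \<nu> :: "real \<times> real \<Rightarrow> real" where
  "\<nu> p = fst p * partial_x \<phi> p + snd p * partial_y \<phi> p"

abbreviation field_y :: "real \<times> real \<Rightarrow> real" where
  "field_y p \<equiv> - fst p - snd p * \<phi> p"

lemma radial_sign': "p \<in> \<Omega> \<Longrightarrow> 0 \<le> \<sigma> * \<nu> p"
  using radial_sign by (simp add: \<nu>_def)

lemma continuous_on_\<phi>: "continuous_on \<Omega> \<phi>"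
  using C1_on_has_derivative[OF open_domain C1] has_derivative_continuous
  by (meson continuous_at_imp_continuous_on)

lemma continuous_on_\<nu>: "continuous_on \<Omega> \<nu>"
  using C1 unfolding \<nu>_def[abs_def] C1_on_def by (intro continuous_intros) auto

text \<open>The ray \<open>s *\<^sub>R p\<close> has velocity \<open>p\<close>, which is its
  position divided by \<open>s\<close>; hence the quotient and the exclusion of
  \<open>s = 0\<close>.\<close>

lemma \<phi>_radial_derivative:
  assumes "s *\<^sub>R p \<in> \<Omega>" "s \<noteq> 0"
  shows "((\<lambda>s. \<phi> (s *\<^sub>R p)) has_real_derivative \<nu> (s *\<^sub>R p) / s) (at s)"
proof -
  have "((\<lambda>s. s *\<^sub>R p) has_vector_derivative (fst p, snd p)) (at s)"
    by (auto intro!: derivative_eq_intros)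
  from C1_on_chain[OF open_domain C1 assms(1) this] show ?thesis
    using \<open>s \<noteq> 0\<close> by (simp add: \<nu>_def add_divide_distrib)
qed

lemma star_scaleR:
  assumes "m *\<^sub>R p \<in> \<Omega>" "0 < s" "s \<le> m"
  shows "s *\<^sub>R p \<in> \<Omega>"
proof -
  have "s *\<^sub>R p = (1 - s / m) *\<^sub>R (0, 0) + (s / m) *\<^sub>R (m *\<^sub>R p)"
    using assms by (simp add: zero_prod_def[symmetric])
  then have "s *\<^sub>R p \<in> closed_segment (0, 0) (m *\<^sub>R p)"
    unfolding in_segment using assms by (intro exI[of _ "s / m"]) auto
  then show ?thesis using star[OF assms(1)] by auto
qed

lemma \<phi>_radial_mono:
  assumes "m *\<^sub>R p \<in> \<Omega>" "0 < s" "s \<le> t" "t \<le> m"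
  shows "\<sigma> * \<phi> (s *\<^sub>R p) \<le> \<sigma> * \<phi> (t *\<^sub>R p)"
proof (rule DERIV_nonneg_imp_nondecreasing[OF \<open>s \<le> t\<close>])
  fix x assume x: "s \<le> x" "x \<le> t"
  then have "x *\<^sub>R p \<in> \<Omega>" using assms star_scaleR[of m p x] by auto
  with x assms show "\<exists>y. ((\<lambda>x. \<sigma> * \<phi> (x *\<^sub>R p)) has_real_derivative y) (at x) \<and> 0 \<le> y"
    using divide_nonneg_pos[OF radial_sign'[of "x *\<^sub>R p"], of x]
    by (intro exI[of _ "\<sigma> * (\<nu> (x *\<^sub>R p) / x)"] conjI DERIV_cmult \<phi>_radial_derivative) auto
qed

text \<open>If \<open>\<nu> p\<close> were nonzero, \<open>\<sigma> * \<phi>\<close> would increase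
  strictly just beyond \<open>p\<close> on its ray, and by monotonicity it could not be back at its
  old value at \<open>m *\<^sub>R p\<close>.\<close>

lemma \<nu>_eq_0_if_\<phi>_eq:
  assumes "m *\<^sub>R p \<in> \<Omega>" "1 < m" "\<phi> (m *\<^sub>R p) = \<phi> p"
  shows "\<nu> p = 0"
proof (rule ccontr)
  assume "\<nu> p \<noteq> 0"
  have p: "p \<in> \<Omega>" using star_scaleR[of m p 1] assms by auto
  then have pos: "0 < \<sigma> * \<nu> p"
    using radial_sign'[OF p] \<open>\<nu> p \<noteq> 0\<close> sign_cases by auto
  have "((\<lambda>s. \<sigma> * \<phi> (s *\<^sub>R p)) has_real_derivative \<sigma> * \<nu> p) (at 1)"
    using \<phi>_radial_derivative[of 1 p] p by (auto intro: DERIV_cmult)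
  then obtain d where d: "d > 0" "\<And>h. 0 < h \<Longrightarrow> h < d \<Longrightarrow> \<sigma> * \<phi> p < \<sigma> * \<phi> ((1 + h) *\<^sub>R p)"
    using DERIV_pos_inc_right[OF _ pos] by force
  define h where "h = min (d / 2) (m - 1)"
  have h: "0 < h" "h < d" "1 + h \<le> m" using d assms by (auto simp: h_def min_def)
  with d(2)[of h] \<phi>_radial_mono[of m p "1 + h" m] assms show False by auto
qed

end


section \<open>A single cycle: angular speed and hyperbolicity\<close>

locale cycle_solution = radially_monotone +
  fixes T :: real and \<gamma> :: "real \<Rightarrow> real \<times> real"
  assumes periodic: "periodic_solution snd (\<lambda>p. - fst p - snd p * \<phi> p) \<Omega> T \<gamma>"
    and nonconstant: "\<not> \<gamma> constant_on UNIV"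
    and no_null_semi_orbit: "\<not> (\<exists>S. nontrivial_positive_semi_orbit snd (\<lambda>p. - fst p - snd p * \<phi> p) \<Omega> S
      \<and> S \<subseteq> {p \<in> \<Omega>. \<nu> p = 0})"
begin

definition x :: "real \<Rightarrow> real" where "x t = fst (\<gamma> t)"

definition y :: "real \<Rightarrow> real" where "y t = snd (\<gamma> t)"

definition D :: "real \<Rightarrow> real" where
  "D t = - (\<phi> (\<gamma> t) + y t * partial_y \<phi> (\<gamma> t))"

definition W :: "real \<Rightarrow> real" where
  "W t = (x t)\<^sup>2 + (y t)\<^sup>2 + x t * y t * \<phi> (\<gamma> t)"

lemma \<gamma>_eq: "\<gamma> t = (x t, y t)"
  by (simp add: x_def y_def)

lemma T_pos: "T > 0"
  and \<gamma>_in: "\<gamma> t \<in> \<Omega>"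
  and \<gamma>_periodic: "\<gamma> (t + T) = \<gamma> t"
  and \<gamma>_derivative: "(\<gamma> has_vector_derivative (y t, - x t - y t * \<phi> (\<gamma> t))) (at t)"
  using periodic unfolding periodic_solution_def solution_on_def by (auto simp: x_def y_def)

lemma x_derivative: "(x has_real_derivative y t) (at t)"
proof -
  have "((\<lambda>t. fst (\<gamma> t)) has_vector_derivative y t) (at t)"
    using bounded_linear.has_vector_derivative[OF bounded_linear_fst \<gamma>_derivative] by simp
  then show ?thesis
    by (simp add: has_real_derivative_iff_has_vector_derivative x_def[abs_def])
qed

lemma y_derivative: "(y has_real_derivative - x t - y t * \<phi> (\<gamma> t)) (at t)"
proof -
  have "((\<lambda>t. snd (\<gamma> t)) has_vector_derivative - x t - y t * \<phi> (\<gamma> t)) (at t)"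
    using bounded_linear.has_vector_derivative[OF bounded_linear_snd \<gamma>_derivative] by simp
  then show ?thesis
    by (simp add: has_real_derivative_iff_has_vector_derivative y_def[abs_def])
qed

lemma \<phi>_derivative:
  "((\<lambda>t. \<phi> (\<gamma> t)) has_real_derivative
    y t * partial_x \<phi> (\<gamma> t) + (- x t - y t * \<phi> (\<gamma> t)) * partial_y \<phi> (\<gamma> t)) (at t)"
  by (rule C1_on_chain[OF open_domain C1 \<gamma>_in \<gamma>_derivative])

text \<open>The terms with the y-partial of \<open>\<phi>\<close> have the common factor
  \<open>x\<^sup>2 + x y \<phi> = W - y\<^sup>2\<close>. The \<open>W\<close> goes into
  \<open>D W\<close>; the remaining \<open>y\<^sup>2\<close> joins the x-partial term to form
  \<open>y\<^sup>2 \<nu>\<close>.\<close>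

lemma W_derivative: "(W has_real_derivative D t * W t + (y t)\<^sup>2 * \<nu> (\<gamma> t)) (at t)"
  unfolding W_def[abs_def]
  by (rule derivative_eq_intros x_derivative y_derivative \<phi>_derivative refl)+
     (simp add: D_def \<nu>_def x_def[symmetric] y_def[symmetric] power2_eq_square algebra_simps)

lemma continuous_on_\<gamma>: "continuous_on A \<gamma>"
  by (intro continuous_at_imp_continuous_on ballI has_vector_derivative_continuous[OF \<gamma>_derivative])

lemma continuous_on_along_\<gamma>:
  assumes "continuous_on \<Omega> f"
  shows "continuous_on A (\<lambda>t. f (\<gamma> t))"
  using continuous_on_compose2[OF assms continuous_on_\<gamma>] \<gamma>_in by auto

lemma continuous_on_coordinates: "continuous_on A x" "continuous_on A y"
  unfolding x_def[abs_def] y_def[abs_def]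
  by (intro continuous_intros continuous_on_\<gamma>)+

lemma continuous_on_W: "continuous_on A W"
  using W_derivative by (meson DERIV_isCont continuous_at_imp_continuous_on)

lemma continuous_on_D: "continuous_on A D"
proof -
  have "continuous_on \<Omega> (partial_y \<phi>)" using C1 by (simp add: C1_on_def)
  then show ?thesis
    unfolding D_def[abs_def]
    by (intro continuous_intros continuous_on_coordinates continuous_on_along_\<gamma> continuous_on_\<phi>)
qed

text \<open>A Gronwall argument: the derivative of \<open>r2\<close> is
  \<open>- 2 y\<^sup>2 \<phi>\<close>, at most \<open>2 N r2\<close> on a compact time interval, so
  a solution that hits the origin stays there. This contradicts non-constancy.\<close>

lemma radius_pos: "0 < (x t)\<^sup>2 + (y t)\<^sup>2"
proof (rule ccontr)
  define r2 where "r2 t = (x t)\<^sup>2 + (y t)\<^sup>2" for t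
  assume "\<not> 0 < (x t)\<^sup>2 + (y t)\<^sup>2"
  then have r2_0: "r2 t = 0"
    using sum_power2_ge_zero[of "x t" "y t"] by (simp add: r2_def)
  have "\<gamma> s = (0, 0)" for s
  proof -
    \<comment> \<open>The estimate works only forward in time; by periodicity every state recurs
      after \<open>t\<close>.\<close>
    obtain u where u: "t \<le> u" "\<gamma> u = \<gamma> s"
      using periodic_representative[of \<gamma> T t s] \<gamma>_periodic T_pos by metis
    obtain M where M: "\<And>v. t \<le> v \<Longrightarrow> v \<le> u \<Longrightarrow> - \<phi> (\<gamma> v) \<le> M"
      using isCont_has_Ub[OF u(1), of "\<lambda>v. - \<phi> (\<gamma> v)"] \<phi>_derivative
      by (metis DERIV_isCont DERIV_minus)
    \<comment> \<open>\<open>N\<close> must be nonnegative for the \<open>x\<^sup>2\<close> term and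
      dominate \<open>- \<phi>\<close> for the \<open>y\<^sup>2\<close> term.\<close>
    define N where "N = max M 0"
    have "r2 u * exp (- 2 * N * u) \<le> r2 t * exp (- 2 * N * t)"
    proof (rule DERIV_nonpos_imp_nonincreasing[OF u(1)])
      fix v assume v: "t \<le> v" "v \<le> u"
      have "((\<lambda>v. r2 v * exp (- 2 * N * v)) has_real_derivative
          - 2 * exp (- 2 * N * v) * (N * r2 v + (y v)\<^sup>2 * \<phi> (\<gamma> v))) (at v)"
        unfolding r2_def
        by (rule derivative_eq_intros x_derivative y_derivative refl)+
           (simp add: power2_eq_square algebra_simps)
      moreover have "0 \<le> N * r2 v + (y v)\<^sup>2 * \<phi> (\<gamma> v)"
      proof -
        have "0 \<le> N * (x v)\<^sup>2 + (N + \<phi> (\<gamma> v)) * (y v)\<^sup>2"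
          using M[OF v] by (intro add_nonneg_nonneg[OF mult_nonneg_nonneg mult_nonneg_nonneg]) (auto simp: N_def)
        then show ?thesis by (simp add: r2_def algebra_simps)
      qed
      ultimately show "\<exists>d. ((\<lambda>v. r2 v * exp (- 2 * N * v)) has_real_derivative d) (at v) \<and> d \<le> 0"
        by (intro exI conjI) (auto simp: mult_nonneg_nonneg)
    qed
    then have "r2 u \<le> 0"
      by (simp add: r2_0 mult_le_0_iff)
    then have "\<gamma> u = (0, 0)"
      using sum_power2_le_zero_iff[of "x u" "y u"] by (simp add: r2_def \<gamma>_eq)
    then show ?thesis using u by simp
  qed
  then show False using nonconstant by (auto simp: constant_on_def)
qed

lemma W_periodic: "W (t + T) = W t"
  by (simp add: W_def x_def y_def \<gamma>_periodic)

lemma W_pos: "0 < W t"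
proof -
  \<comment> \<open>Rolle applied to the periodic function \<open>x\<close>, whose derivative is
    \<open>y\<close>. At such a time \<open>W\<close> reduces to the squared radius.\<close>
  obtain t0 where "y t0 = 0"
  proof -
    have "\<exists>z. 0 < z \<and> z < T \<and> (x has_real_derivative 0) (at z)"
      using \<gamma>_periodic[of 0] x_derivative
      by (intro Rolle T_pos continuous_on_coordinates)
         (auto simp: x_def real_differentiable_def)
    then show thesis using that x_derivative DERIV_unique by blast
  qed
  then have "0 < W t0" using radius_pos[of t0] by (simp add: W_def)
  then have W_ends: "0 < W t0" "0 < W (t0 + T)" by (simp_all add: W_periodic)
  obtain s where s: "t0 \<le> s" "s < t0 + T" "W s = W t"
    using periodic_representative[of W T t0 t] W_periodic T_pos by metis
  obtain F where F: "\<And>t. (F has_real_derivative D t) (at t)"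
    using continuous_antiderivative_UNIV[OF continuous_on_D] by blast
  have W_integrating: "((\<lambda>t. W t * exp (- F t)) has_real_derivative
      (y t)\<^sup>2 * \<nu> (\<gamma> t) * exp (- F t)) (at t)" for t
    by (rule derivative_eq_intros W_derivative F refl)+ (simp add: algebra_simps)
  have "0 < W s * exp (- F s)"
  \<comment> \<open>The product \<open>W * exp (- F)\<close> is nondecreasing for
    \<open>\<sigma> = 1\<close> and nonincreasing for \<open>\<sigma> = - 1\<close>, so positivity
    is carried from the left end \<open>t0\<close> or from the right end
    \<open>t0 + T\<close>.\<close>
  proof (cases "\<sigma> = 1")
    case True
    have "W t0 * exp (- F t0) \<le> W s * exp (- F s)"
      using W_integrating radial_sign'[OF \<gamma>_in] True
      by (intro DERIV_nonneg_imp_nondecreasing[OF s(1)]) fastforce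
    then show ?thesis
      using W_ends by (meson exp_gt_zero less_le_trans mult_pos_pos)
  next
    case False
    then have "\<sigma> = - 1" using sign_cases by simp
    then have "(y t)\<^sup>2 * \<nu> (\<gamma> t) * exp (- F t) \<le> 0" for t
      using radial_sign'[OF \<gamma>_in] by (simp add: mult_nonneg_nonpos mult_nonpos_nonneg)
    then have "W (t0 + T) * exp (- F (t0 + T)) \<le> W s * exp (- F s)"
      using W_integrating s
      by (intro DERIV_nonpos_imp_nonincreasing[of s "t0 + T"]) (auto simp del: mult_le_0_iff)
    then show ?thesis
      using W_ends by (meson exp_gt_zero less_le_trans mult_pos_pos)
  qed
  then show ?thesis using s(3) by (simp add: zero_less_mult_iff)
qed

text \<open>Maximality is immediate, since \<open>{0..}\<close> is already the largest interval that
  the definition admits. Recurrence turns a one-point image into a constant solution.\<close>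

lemma semi_orbit: "nontrivial_positive_semi_orbit snd field_y \<Omega> (\<gamma> ` {0..})"
proof -
  have "positive_semi_orbit snd field_y \<Omega> (\<gamma> ` {0..})"
    unfolding positive_semi_orbit_def
  proof (intro exI conjI)
    show "solution_on snd field_y \<Omega> {0..} \<gamma>"
      using periodic unfolding periodic_solution_def solution_on_def
      by (auto intro: has_vector_derivative_at_within)
  qed (auto simp: is_interval_ci)
  moreover have "\<gamma> ` {0..} \<noteq> {p}" for p
  proof
    assume eq: "\<gamma> ` {0..} = {p}"
    have "\<gamma> t = p" for t
      using periodic_representative[of \<gamma> T 0 t] \<gamma>_periodic T_pos eq
      by (metis atLeast_iff imageI singletonD)
    then show False using nonconstant by (auto simp: constant_on_def)
  qed
  ultimately show ?thesis
    unfolding nontrivial_positive_semi_orbit_def by blast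
qed

text \<open>Needed because \<open>\<nu>\<close> enters the later arguments with a factor
  \<open>y\<^sup>2\<close>. Zeros of \<open>y\<close> are isolated, since there \<open>y\<close> has
  derivative \<open>- x\<close>, which is nonzero; continuity then extends \<open>\<nu> = 0\<close>
  from off the axis to the whole cycle.\<close>

lemma \<nu>_not_null_off_axis: "\<exists>t. y t \<noteq> 0 \<and> \<nu> (\<gamma> t) \<noteq> 0"
proof (rule ccontr)
  assume "\<not> ?thesis"
  then have null: "\<nu> (\<gamma> t) = 0" if "y t \<noteq> 0" for t using that by auto
  have "\<nu> (\<gamma> t) = 0" for t
  proof (cases "y t = 0")
    case True
    have "\<forall>\<^sub>F s in at t. y s \<noteq> 0"
    proof -
      have "x t \<noteq> 0" using radius_pos[of t] True by auto
      moreover have "((\<lambda>s. (y s - y t) / (s - t)) \<longlongrightarrow> - x t) (at t)"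
        using y_derivative[of t] True by (simp add: has_field_derivative_iff)
      ultimately have "\<forall>\<^sub>F s in at t. (y s - y t) / (s - t) \<noteq> 0"
        by (intro tendsto_imp_eventually_ne[of _ "- x t"]) auto
      then show ?thesis by eventually_elim (auto simp: True)
    qed
    then have "\<forall>\<^sub>F s in at t. \<nu> (\<gamma> s) = 0" by eventually_elim (simp add: null)
    then have "((\<lambda>s. \<nu> (\<gamma> s)) \<longlongrightarrow> 0) (at t)" by (rule tendsto_eventually)
    moreover have "((\<lambda>s. \<nu> (\<gamma> s)) \<longlongrightarrow> \<nu> (\<gamma> t)) (at t)"
      using continuous_on_along_\<gamma>[OF continuous_on_\<nu>, of UNIV]
      by (simp add: continuous_on_def)
    ultimately show ?thesis using tendsto_unique at_neq_bot by blast
  qed (rule null)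
  then have "\<gamma> ` {0..} \<subseteq> {p \<in> \<Omega>. \<nu> p = 0}" using \<gamma>_in by auto
  then show False using no_null_semi_orbit semi_orbit by blast
qed

lemma divergence_eq: "partial_x snd (\<gamma> t) + partial_y field_y (\<gamma> t) = D t"
proof -
  have "((\<lambda>s. \<phi> (x t, s)) has_real_derivative partial_y \<phi> (\<gamma> t)) (at (y t))"
    using C1 \<gamma>_in[of t] unfolding C1_on_def partial_y_def
    by (auto simp: \<gamma>_eq DERIV_deriv_iff_real_differentiable)
  then have "((\<lambda>s. - x t - s * \<phi> (x t, s)) has_real_derivative D t) (at (y t))"
    by (auto intro!: derivative_eq_intros simp: D_def \<gamma>_eq)
  then have "partial_y field_y (\<gamma> t) = D t"
    by (simp add: partial_y_def \<gamma>_eq DERIV_imp_deriv)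
  then show ?thesis by (simp add: partial_x_def)
qed

lemma divergence_integral_nonzero:
  "integral {0..T} (\<lambda>t. partial_x snd (\<gamma> t) + partial_y field_y (\<gamma> t)) \<noteq> 0"
proof
  assume "integral {0..T} (\<lambda>t. partial_x snd (\<gamma> t) + partial_y field_y (\<gamma> t)) = 0"
  then have D_0: "integral {0..T} D = 0" by (simp add: divergence_eq)
  \<comment> \<open>The logarithmic derivative of \<open>W\<close> is \<open>D + g\<close>, and
    \<open>\<sigma> * g\<close> is continuous and nonnegative, so a vanishing integral makes it
    vanish pointwise.\<close>
  define g where "g t = (y t)\<^sup>2 * \<nu> (\<gamma> t) / W t" for t
  have cont_g: "continuous_on A g" for A
    unfolding g_def using W_pos
    by (intro continuous_intros continuous_on_coordinates continuous_on_along_\<gamma> continuous_on_\<nu>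
        continuous_on_W) (metis less_irrefl)
  have "((\<lambda>t. ln (W t)) has_vector_derivative D t + g t) (at t within {0..T})" for t
  proof -
    have "((\<lambda>t. ln (W t)) has_real_derivative D t + g t) (at t)"
      using W_pos[of t] by (auto intro!: derivative_eq_intros W_derivative simp: g_def field_simps)
    then show ?thesis
      using has_real_derivative_iff_has_vector_derivative has_vector_derivative_at_within by blast
  qed
  then have "((\<lambda>t. D t + g t) has_integral ln (W T) - ln (W 0)) {0..T}"
    using T_pos by (intro fundamental_theorem_of_calculus) auto
  moreover have "W T = W 0" using W_periodic[of 0] by simp
  ultimately have "integral {0..T} (\<lambda>t. D t + g t) = 0" by (simp add: integral_unique)
  then have "integral {0..T} g = 0"
    using D_0 integral_add[of D "{0..T}" g]
    by (simp add: integrable_continuous_real continuous_on_D cont_g)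
  then have \<sigma>g_0: "integral {0..T} (\<lambda>t. \<sigma> * g t) = 0" by simp
  obtain t where t: "y t \<noteq> 0" "\<nu> (\<gamma> t) \<noteq> 0" using \<nu>_not_null_off_axis by blast
  obtain s where s: "0 \<le> s" "s < T" "\<gamma> s = \<gamma> t"
    using periodic_representative[of \<gamma> T 0 t] \<gamma>_periodic T_pos by (metis add_0)
  have "\<sigma> * g s = 0"
  proof -
    have "0 \<le> \<sigma> * g t" for t
      using divide_nonneg_pos[OF mult_nonneg_nonneg[OF zero_le_power2 radial_sign'[OF \<gamma>_in]] W_pos]
      by (simp add: g_def mult.left_commute)
    moreover have "continuous_on {0..T} (\<lambda>t. \<sigma> * g t)"
      by (intro continuous_intros cont_g)
    ultimately have "\<forall>t\<in>{0..T}. \<sigma> * g t = 0"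
      using \<sigma>g_0 integral_eq_0_iff[of 0 T "\<lambda>t. \<sigma> * g t"] T_pos by blast
    then show ?thesis using s(1,2) by (meson atLeastAtMost_iff less_imp_le)
  qed
  then show False
    using s t sign_cases W_pos[of s] by (auto simp: g_def y_def)
qed


section \<open>Polar parametrization of a cycle\<close>

text \<open>The angle runs clockwise, in the direction of the flow. The integer \<open>k\<close> counts the turns
  during the period \<open>T\<close>, which need not be minimal.\<close>

lemma polar_graph:
  obtains \<rho> :: "real \<Rightarrow> real" and k :: nat where
    "k > 0" "\<And>\<theta>. \<rho> (\<theta> + of_nat k * (2 * pi)) = \<rho> \<theta>" "\<And>\<theta>. 0 < \<rho> \<theta>"
    "range \<gamma> = range (\<lambda>\<theta>. \<rho> \<theta> *\<^sub>R (cos \<theta>, - sin \<theta>))"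
    "\<And>\<theta>. 0 < 1 - sin \<theta> * cos \<theta> * \<phi> (\<rho> \<theta> *\<^sub>R (cos \<theta>, - sin \<theta>))"
    "\<And>\<theta>. ((\<lambda>\<theta>. ln (\<rho> \<theta>)) has_real_derivative
      - (sin \<theta>)\<^sup>2 * \<phi> (\<rho> \<theta> *\<^sub>R (cos \<theta>, - sin \<theta>)) /
        (1 - sin \<theta> * cos \<theta> * \<phi> (\<rho> \<theta> *\<^sub>R (cos \<theta>, - sin \<theta>)))) (at \<theta>)"
proof -
  define r where "r t = sqrt ((x t)\<^sup>2 + (y t)\<^sup>2)" for t
  have r_pos: "0 < r t" for t using radius_pos[of t] by (simp add: r_def)
  have r_sq: "(r t)\<^sup>2 = (x t)\<^sup>2 + (y t)\<^sup>2" for t by (simp add: r_def)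
  have r_derivative: "(r has_real_derivative - ((y t)\<^sup>2 * \<phi> (\<gamma> t)) / r t) (at t)" for t
  proof -
    have "((\<lambda>t. (x t)\<^sup>2 + (y t)\<^sup>2) has_real_derivative - 2 * ((y t)\<^sup>2 * \<phi> (\<gamma> t))) (at t)"
      by (rule derivative_eq_intros x_derivative y_derivative refl)+
         (simp add: power2_eq_square algebra_simps)
    from DERIV_chain2[where f = sqrt, OF DERIV_real_sqrt[OF radius_pos[of t]] this]
    have "(r has_real_derivative
        inverse (r t) / 2 * (- 2 * ((y t)\<^sup>2 * \<phi> (\<gamma> t)))) (at t)"
      by (simp only: r_def[abs_def])
    then show ?thesis
      by (rule DERIV_cong) (use r_pos[of t] in \<open>simp add: field_simps\<close>)
  qed
  \<comment> \<open>The clockwise angular speed; its antiderivative \<open>\<psi>\<close>, started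
    at the initial angle \<open>a\<close>, is the lifted angle.\<close>
  define \<omega> where "\<omega> t = W t / (r t)\<^sup>2" for t
  have \<omega>_pos: "0 < \<omega> t" for t unfolding \<omega>_def by (intro divide_pos_pos W_pos zero_less_power r_pos)
  have "continuous_on UNIV r"
    using r_derivative by (meson DERIV_isCont continuous_at_imp_continuous_on)
  then have "continuous_on UNIV \<omega>"
    unfolding \<omega>_def[abs_def] using r_pos
    by (intro continuous_intros continuous_on_W) (auto simp: less_imp_neq[symmetric])
  then obtain F where F: "\<And>t. (F has_real_derivative \<omega> t) (at t)"
    using continuous_antiderivative_UNIV by blast
  have "(x 0 / r 0)\<^sup>2 + (- y 0 / r 0)\<^sup>2 = 1"
    using r_pos[of 0] by (simp add: power_divide add_divide_distrib[symmetric] r_sq[symmetric])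
  then obtain a where a: "x 0 / r 0 = cos a" "- y 0 / r 0 = sin a"
    using sincos_total_2pi_le by metis
  define \<psi> where "\<psi> t = F t - F 0 + a" for t
  have \<psi>_derivative: "(\<psi> has_real_derivative \<omega> t) (at t)" for t
    unfolding \<psi>_def[abs_def] by (auto intro!: derivative_eq_intros F)

  have polar: "x t = r t * cos (\<psi> t)" "y t = - r t * sin (\<psi> t)" for t
  proof -
    \<comment> \<open>The unit vectors \<open>(X, Y)\<close> and
      \<open>(cos \<psi>, - sin \<psi>)\<close> obey the same rotation equation, so their inner
      product keeps its initial value 1. Unit vectors with inner product 1 are equal.\<close>
    define X Y where "X t = x t / r t" and "Y t = y t / r t" for t
    have X_derivative: "(X has_real_derivative \<omega> t * Y t) (at t)" for t
    proof -
      have "(X has_real_derivative (y t * r t - x t * (- ((y t)\<^sup>2 * \<phi> (\<gamma> t)) / r t)) / (r t * r t)) (at t)"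
        unfolding X_def[abs_def]
        using r_pos[of t] by (intro DERIV_divide x_derivative r_derivative) auto
      moreover have "(y t * r t - x t * (- ((y t)\<^sup>2 * \<phi> (\<gamma> t)) / r t)) / (r t * r t)
          = y t * ((r t)\<^sup>2 + x t * y t * \<phi> (\<gamma> t)) / (r t)^3"
        using r_pos[of t] by (simp add: field_simps power2_eq_square power3_eq_cube)
      ultimately show ?thesis
        unfolding r_sq by (simp add: \<omega>_def W_def Y_def power2_eq_square power3_eq_cube mult_ac)
    qed
    have Y_derivative: "(Y has_real_derivative - \<omega> t * X t) (at t)" for t
    proof -
      have "(Y has_real_derivative ((- x t - y t * \<phi> (\<gamma> t)) * r t
          - y t * (- ((y t)\<^sup>2 * \<phi> (\<gamma> t)) / r t)) / (r t * r t)) (at t)"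
        unfolding Y_def[abs_def]
        using r_pos[of t] by (intro DERIV_divide y_derivative r_derivative) auto
      moreover have "((- x t - y t * \<phi> (\<gamma> t)) * r t - y t * (- ((y t)\<^sup>2 * \<phi> (\<gamma> t)) / r t)) / (r t * r t)
          = - (x t * (r t)\<^sup>2 + y t * \<phi> (\<gamma> t) * ((r t)\<^sup>2 - (y t)\<^sup>2)) / (r t)^3"
        using r_pos[of t] by (simp add: field_simps power2_eq_square power3_eq_cube)
      moreover have "x t * (r t)\<^sup>2 + y t * \<phi> (\<gamma> t) * ((r t)\<^sup>2 - (y t)\<^sup>2) = x t * W t"
        unfolding r_sq W_def by (simp add: power2_eq_square algebra_simps)
      ultimately have "(Y has_real_derivative - (x t * W t) / (r t)^3) (at t)"
        by (simp only:)
      then show ?thesis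
        by (rule DERIV_cong) (simp add: \<omega>_def X_def power2_eq_square power3_eq_cube mult_ac)
    qed
    have "((\<lambda>t. X t * cos (\<psi> t) - Y t * sin (\<psi> t)) has_real_derivative 0) (at t)" for t
      by (rule derivative_eq_intros X_derivative Y_derivative \<psi>_derivative refl)+
         (simp add: algebra_simps)
    then have "X t * cos (\<psi> t) - Y t * sin (\<psi> t) = X 0 * cos (\<psi> 0) - Y 0 * sin (\<psi> 0)"
      using DERIV_isconst_all by blast
    also have "\<dots> = 1"
    proof -
      have "X 0 = cos a" "Y 0 = - sin a" "\<psi> 0 = a"
        using a by (simp_all add: X_def Y_def \<psi>_def)
      then show ?thesis by (simp add: power2_eq_square[symmetric])
    qed
    finally have inner: "X t * cos (\<psi> t) - Y t * sin (\<psi> t) = 1" .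
    have unit: "(X t)\<^sup>2 + (Y t)\<^sup>2 = 1"
      using r_pos[of t]
      by (simp add: X_def Y_def power_divide add_divide_distrib[symmetric] r_sq[symmetric])
    have "(X t - cos (\<psi> t))\<^sup>2 + (Y t + sin (\<psi> t))\<^sup>2
        = ((X t)\<^sup>2 + (Y t)\<^sup>2) + ((cos (\<psi> t))\<^sup>2 + (sin (\<psi> t))\<^sup>2) - 2 * (X t * cos (\<psi> t) - Y t * sin (\<psi> t))"
      by (simp add: power2_eq_square algebra_simps)
    also have "\<dots> = 0" by (simp add: inner unit)
    finally have "X t = cos (\<psi> t)" "Y t = - sin (\<psi> t)"
      by (auto simp: sum_power2_eq_zero_iff)
    then show "x t = r t * cos (\<psi> t)" "y t = - r t * sin (\<psi> t)"
      using r_pos[of t] by (simp_all add: X_def Y_def field_simps)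
  qed

  have r_periodic: "r (t + T) = r t" for t
    by (simp add: r_def x_def y_def \<gamma>_periodic)
  have \<psi>_less: "\<psi> s < \<psi> t" if "s < t" for s t
    using DERIV_pos_imp_increasing[OF that] \<psi>_derivative \<omega>_pos by metis
  define c where "c = \<psi> T - \<psi> 0"
  have c_pos: "0 < c" using \<psi>_less[OF T_pos] by (simp add: c_def)
  have \<psi>_shift: "\<psi> (t + T) = \<psi> t + c" for t
  proof -
    have "\<omega> (t + T) = \<omega> t" for t
      by (simp add: \<omega>_def W_periodic r_periodic)
    then have "((\<lambda>t. \<psi> (t + T) - \<psi> t) has_real_derivative 0) (at t)" for t
      using DERIV_shift[of \<psi> _ t T] \<psi>_derivative
      by (auto intro!: derivative_eq_intros)
    from DERIV_isconst_all[of "\<lambda>t. \<psi> (t + T) - \<psi> t" t 0] this show ?thesis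
      by (simp add: c_def)
  qed
  \<comment> \<open>After one period the direction is the same, so the angle gained is an integer
    multiple of \<open>2 * pi\<close>, positive because \<open>\<psi>\<close> increases.\<close>
  obtain k :: nat where k: "k > 0" "c = of_nat k * (2 * pi)"
  proof -
    have "cos (\<psi> T) = cos (\<psi> 0)" "sin (\<psi> T) = sin (\<psi> 0)"
      using polar[of T] polar[of 0] r_periodic[of 0] r_pos[of 0] \<gamma>_periodic[of 0]
      by (auto simp: x_def y_def)
    then obtain n :: int where n: "\<psi> T = \<psi> 0 + 2 * pi * n"
      using sin_cos_eq_iff by metis
    then have "0 < 2 * pi * n" using c_pos by (simp add: c_def)
    then have "n > 0" by (simp add: zero_less_mult_iff)
    then show thesis using that[of "nat n"] n by (simp add: c_def)
  qed

  have \<psi>_onto: "\<exists>t. \<psi> t = \<theta>" for \<theta>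
  proof -
    \<comment> \<open>Removing the mean slope leaves a periodic function, which gives
      \<open>\<psi>\<close> at the times \<open>n T\<close> and \<open>- n T\<close> exactly; the
      intermediate value theorem then reaches every angle.\<close>
    define h where "h t = \<psi> t - c / T * t" for t
    have h_periodic: "h (t + T) = h t" for t
      unfolding h_def \<psi>_shift using T_pos by (simp add: field_simps)
    obtain n :: nat where n: "\<bar>\<theta> - \<psi> 0\<bar> < of_nat n * c"
      using reals_Archimedean3[OF c_pos] by blast
    have "h (of_nat n * T) = h 0" "h (- (of_nat n * T)) = h 0"
      using periodic_add_of_nat_mult[of h T 0 n] periodic_add_of_nat_mult[of h T "- (of_nat n * T)" n]
        h_periodic by simp_all
    then have "\<psi> (of_nat n * T) = \<psi> 0 + of_nat n * c" "\<psi> (- (of_nat n * T)) = \<psi> 0 - of_nat n * c"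
      using T_pos by (simp_all add: h_def field_simps)
    then have "\<exists>t\<ge>- (of_nat n * T). t \<le> of_nat n * T \<and> \<psi> t = \<theta>"
      using n T_pos \<psi>_derivative
      by (intro IVT) (auto intro: DERIV_isCont)
    then show ?thesis by blast
  qed
  have "surj \<psi>" unfolding surj_def using \<psi>_onto by metis
  moreover have "inj \<psi>"
  proof (rule injI)
    fix s t assume "\<psi> s = \<psi> t"
    then show "s = t" using \<psi>_less[of s t] \<psi>_less[of t s] by (cases s t rule: linorder_cases) auto
  qed
  ultimately have "bij \<psi>" by (simp add: bij_def)
  define \<tau> where "\<tau> = inv \<psi>"
  have \<psi>\<tau>: "\<psi> (\<tau> \<theta>) = \<theta>" and \<tau>\<psi>: "\<tau> (\<psi> t) = t" for \<theta> t
    using \<open>bij \<psi>\<close> by (simp_all add: \<tau>_def bij_is_inj bij_is_surj surj_f_inv_f)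
  have \<tau>_cont: "isCont \<tau> \<theta>" for \<theta>
  proof -
    have "isCont \<tau> (\<psi> (\<tau> \<theta>))"
    proof (rule isCont_inverse_function[where f = \<psi> and d = 1])
      show "\<tau> (\<psi> z) = z" for z by (rule \<tau>\<psi>)
      show "isCont \<psi> z" for z by (rule DERIV_isCont[OF \<psi>_derivative])
    qed simp
    then show ?thesis by (simp only: \<psi>\<tau>)
  qed
  have \<tau>_derivative: "(\<tau> has_real_derivative inverse (\<omega> (\<tau> \<theta>))) (at \<theta>)" for \<theta>
  proof (rule DERIV_inverse_function[OF \<psi>_derivative])
    show "\<omega> (\<tau> \<theta>) \<noteq> 0" using \<omega>_pos[of "\<tau> \<theta>"] by simp
    show "\<theta> - 1 < \<theta>" "\<theta> < \<theta> + 1" by simp_all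
  qed (rule \<psi>\<tau> \<tau>_cont)+

  define \<rho> where "\<rho> \<theta> = r (\<tau> \<theta>)" for \<theta>
  have \<gamma>_polar: "\<gamma> (\<tau> \<theta>) = \<rho> \<theta> *\<^sub>R (cos \<theta>, - sin \<theta>)" for \<theta>
    by (simp add: \<gamma>_eq polar \<psi>\<tau> \<rho>_def)
  have \<omega>_polar: "\<omega> (\<tau> \<theta>) = 1 - sin \<theta> * cos \<theta> * \<phi> (\<rho> \<theta> *\<^sub>R (cos \<theta>, - sin \<theta>))" for \<theta>
  proof -
    have "W (\<tau> \<theta>) = (r (\<tau> \<theta>))\<^sup>2 + x (\<tau> \<theta>) * y (\<tau> \<theta>) * \<phi> (\<gamma> (\<tau> \<theta>))"
      by (simp add: W_def r_sq)
    also have "\<dots> = (\<rho> \<theta>)\<^sup>2 * (1 - sin \<theta> * cos \<theta> * \<phi> (\<gamma> (\<tau> \<theta>)))"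
      by (simp add: polar \<psi>\<tau> \<rho>_def power2_eq_square algebra_simps)
    finally show ?thesis
      using r_pos[of "\<tau> \<theta>"] by (simp add: \<omega>_def \<rho>_def \<gamma>_polar)
  qed
  show thesis
  proof
    show "k > 0" by (rule k(1))
    show "0 < \<rho> \<theta>" for \<theta> by (simp add: \<rho>_def r_pos)
    \<comment> \<open>The inverse \<open>\<tau>\<close> of the angle turns a shift by
      \<open>c\<close> into a shift by one time period, under which \<open>r\<close> is
      invariant.\<close>
    have "\<tau> (\<theta> + c) = \<tau> \<theta> + T" for \<theta>
      using \<tau>\<psi>[of "\<tau> \<theta> + T"] by (simp add: \<psi>_shift \<psi>\<tau>)
    then show "\<rho> (\<theta> + of_nat k * (2 * pi)) = \<rho> \<theta>" for \<theta>
      by (simp add: \<rho>_def r_periodic k(2)[symmetric])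
    show "range \<gamma> = range (\<lambda>\<theta>. \<rho> \<theta> *\<^sub>R (cos \<theta>, - sin \<theta>))"
      unfolding \<gamma>_polar[symmetric] by (auto simp: image_iff) (metis \<tau>\<psi>)
    show "0 < 1 - sin \<theta> * cos \<theta> * \<phi> (\<rho> \<theta> *\<^sub>R (cos \<theta>, - sin \<theta>))" for \<theta>
      using \<omega>_pos \<omega>_polar by metis
    fix \<theta>
    have "((\<lambda>\<theta>. r (\<tau> \<theta>)) has_real_derivative
        - ((y (\<tau> \<theta>))\<^sup>2 * \<phi> (\<gamma> (\<tau> \<theta>))) / r (\<tau> \<theta>) * inverse (\<omega> (\<tau> \<theta>))) (at \<theta>)"
      by (rule DERIV_chain2[OF r_derivative \<tau>_derivative])
    then have "((\<lambda>\<theta>. ln (\<rho> \<theta>)) has_real_derivative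
        1 / \<rho> \<theta> * (- ((y (\<tau> \<theta>))\<^sup>2 * \<phi> (\<gamma> (\<tau> \<theta>))) / r (\<tau> \<theta>) * inverse (\<omega> (\<tau> \<theta>)))) (at \<theta>)"
      unfolding \<rho>_def by (intro DERIV_chain2[OF DERIV_ln_divide]) (auto simp: r_pos)
    moreover have "1 / \<rho> \<theta> * (- ((y (\<tau> \<theta>))\<^sup>2 * \<phi> (\<gamma> (\<tau> \<theta>))) / r (\<tau> \<theta>) * inverse (\<omega> (\<tau> \<theta>)))
        = - (sin \<theta>)\<^sup>2 * \<phi> (\<gamma> (\<tau> \<theta>)) / \<omega> (\<tau> \<theta>)"
      using r_pos[of "\<tau> \<theta>"] \<omega>_pos[of "\<tau> \<theta>"]
      by (simp add: polar \<psi>\<tau> \<rho>_def power2_eq_square field_simps)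
    ultimately show "((\<lambda>\<theta>. ln (\<rho> \<theta>)) has_real_derivative
      - (sin \<theta>)\<^sup>2 * \<phi> (\<rho> \<theta> *\<^sub>R (cos \<theta>, - sin \<theta>)) /
        (1 - sin \<theta> * cos \<theta> * \<phi> (\<rho> \<theta> *\<^sub>R (cos \<theta>, - sin \<theta>)))) (at \<theta>)"
      by (simp only: \<gamma>_polar \<omega>_polar)
  qed
qed

end

section \<open>Comparison of two cycles\<close>

context radially_monotone
begin

text \<open>Excludes nested graphs carrying equal values of \<open>\<phi>\<close>: the inner cycle
  has a point off the axis with \<open>\<nu>\<close> nonzero, yet
  \<open>\<nu>_eq_0_if_\<phi>_eq\<close> with \<open>m = \<rho>' / \<rho>\<close> forces it to
  vanish there.\<close>

lemma no_radial_equality: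
  assumes "cycle_solution \<Omega> \<phi> \<sigma> T \<gamma>"
    and graph: "range \<gamma> = range (\<lambda>\<theta>. \<rho> \<theta> *\<^sub>R (cos \<theta>, - sin \<theta>))"
    and less: "\<And>\<theta>. 0 < \<rho> \<theta>" "\<And>\<theta>. \<rho> \<theta> < \<rho>' \<theta>"
    and inside: "\<And>\<theta>. \<rho>' \<theta> *\<^sub>R (cos \<theta>, - sin \<theta>) \<in> \<Omega>"
    and eq: "\<And>\<theta>. sin \<theta> \<noteq> 0 \<Longrightarrow>
      \<phi> (\<rho>' \<theta> *\<^sub>R (cos \<theta>, - sin \<theta>)) = \<phi> (\<rho> \<theta> *\<^sub>R (cos \<theta>, - sin \<theta>))"
  shows False
proof -
  interpret cycle_solution \<Omega> \<phi> \<sigma> T \<gamma> by fact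
  obtain t where t: "y t \<noteq> 0" "\<nu> (\<gamma> t) \<noteq> 0" using \<nu>_not_null_off_axis by blast
  obtain \<theta> where \<theta>: "\<gamma> t = \<rho> \<theta> *\<^sub>R (cos \<theta>, - sin \<theta>)" using graph by blast
  have "\<nu> (\<gamma> t) = 0"
  proof (rule \<nu>_eq_0_if_\<phi>_eq)
    have scale: "(\<rho>' \<theta> / \<rho> \<theta>) *\<^sub>R \<gamma> t = \<rho>' \<theta> *\<^sub>R (cos \<theta>, - sin \<theta>)"
      using less(1)[of \<theta>] by (simp add: \<theta>)
    show "(\<rho>' \<theta> / \<rho> \<theta>) *\<^sub>R \<gamma> t \<in> \<Omega>" unfolding scale by (rule inside)
    show "1 < \<rho>' \<theta> / \<rho> \<theta>" using less by simp
    have "sin \<theta> \<noteq> 0" using t(1) \<theta> by (auto simp: y_def)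
    then show "\<phi> ((\<rho>' \<theta> / \<rho> \<theta>) *\<^sub>R \<gamma> t) = \<phi> (\<gamma> t)"
      unfolding scale unfolding \<theta> by (rule eq)
  qed
  with t show False by simp
qed

lemma cycles_coincide:
  assumes "cycle_solution \<Omega> \<phi> \<sigma> T1 \<gamma>1" "cycle_solution \<Omega> \<phi> \<sigma> T2 \<gamma>2"
  shows "range \<gamma>1 = range \<gamma>2"
proof -
  interpret c1: cycle_solution \<Omega> \<phi> \<sigma> T1 \<gamma>1 by fact
  interpret c2: cycle_solution \<Omega> \<phi> \<sigma> T2 \<gamma>2 by fact
  define e where "e \<theta> = (cos \<theta>, - sin \<theta>)" for \<theta> :: real
  obtain \<rho>1 :: "real \<Rightarrow> real" and k1 :: nat where k1: "k1 > 0"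
    and per1: "\<And>\<theta>. \<rho>1 (\<theta> + of_nat k1 * (2 * pi)) = \<rho>1 \<theta>"
    and pos1: "\<And>\<theta>. 0 < \<rho>1 \<theta>"
    and graph1: "range \<gamma>1 = range (\<lambda>\<theta>. \<rho>1 \<theta> *\<^sub>R e \<theta>)"
    and w1: "\<And>\<theta>. 0 < 1 - sin \<theta> * cos \<theta> * \<phi> (\<rho>1 \<theta> *\<^sub>R e \<theta>)"
    and deriv1: "\<And>\<theta>. ((\<lambda>\<theta>. ln (\<rho>1 \<theta>)) has_real_derivative
      - (sin \<theta>)\<^sup>2 * \<phi> (\<rho>1 \<theta> *\<^sub>R e \<theta>) / (1 - sin \<theta> * cos \<theta> * \<phi> (\<rho>1 \<theta> *\<^sub>R e \<theta>))) (at \<theta>)"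
    by (rule c1.polar_graph) (rule that[unfolded e_def]; assumption)
  obtain \<rho>2 :: "real \<Rightarrow> real" and k2 :: nat where k2: "k2 > 0"
    and per2: "\<And>\<theta>. \<rho>2 (\<theta> + of_nat k2 * (2 * pi)) = \<rho>2 \<theta>"
    and pos2: "\<And>\<theta>. 0 < \<rho>2 \<theta>"
    and graph2: "range \<gamma>2 = range (\<lambda>\<theta>. \<rho>2 \<theta> *\<^sub>R e \<theta>)"
    and w2: "\<And>\<theta>. 0 < 1 - sin \<theta> * cos \<theta> * \<phi> (\<rho>2 \<theta> *\<^sub>R e \<theta>)"
    and deriv2: "\<And>\<theta>. ((\<lambda>\<theta>. ln (\<rho>2 \<theta>)) has_real_derivative
      - (sin \<theta>)\<^sup>2 * \<phi> (\<rho>2 \<theta> *\<^sub>R e \<theta>) / (1 - sin \<theta> * cos \<theta> * \<phi> (\<rho>2 \<theta> *\<^sub>R e \<theta>))) (at \<theta>)"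
    by (rule c2.polar_graph) (rule that[unfolded e_def]; assumption)
  have in1: "\<rho>1 \<theta> *\<^sub>R e \<theta> \<in> \<Omega>" for \<theta>
  proof -
    have "\<rho>1 \<theta> *\<^sub>R e \<theta> \<in> range \<gamma>1" unfolding graph1 by (rule rangeI)
    then show ?thesis using c1.\<gamma>_in by auto
  qed
  have in2: "\<rho>2 \<theta> *\<^sub>R e \<theta> \<in> \<Omega>" for \<theta>
  proof -
    have "\<rho>2 \<theta> *\<^sub>R e \<theta> \<in> range \<gamma>2" unfolding graph2 by (rule rangeI)
    then show ?thesis using c2.\<gamma>_in by auto
  qed

  define u where "u \<theta> = ln (\<rho>2 \<theta>) - ln (\<rho>1 \<theta>)" for \<theta>
  define q where "q \<theta> = (sin \<theta>)\<^sup>2 / ((1 - sin \<theta> * cos \<theta> * \<phi> (\<rho>1 \<theta> *\<^sub>R e \<theta>)) *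
    (1 - sin \<theta> * cos \<theta> * \<phi> (\<rho>2 \<theta> *\<^sub>R e \<theta>)))" for \<theta>
  define \<delta> where "\<delta> \<theta> = \<phi> (\<rho>2 \<theta> *\<^sub>R e \<theta>) - \<phi> (\<rho>1 \<theta> *\<^sub>R e \<theta>)" for \<theta>
  have q_nonneg: "0 \<le> q \<theta>" for \<theta>
    unfolding q_def using w1[of \<theta>] w2[of \<theta>] by (intro divide_nonneg_pos mult_pos_pos) auto
  have u_derivative: "(u has_real_derivative - (q \<theta> * \<delta> \<theta>)) (at \<theta>)" for \<theta>
  proof -
    define a b where "a = 1 - sin \<theta> * cos \<theta> * \<phi> (\<rho>1 \<theta> *\<^sub>R e \<theta>)"
      and "b = 1 - sin \<theta> * cos \<theta> * \<phi> (\<rho>2 \<theta> *\<^sub>R e \<theta>)"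
    have ab: "a > 0" "b > 0" using w1 w2 by (simp_all add: a_def b_def)
    have "- (sin \<theta>)\<^sup>2 * \<phi> (\<rho>2 \<theta> *\<^sub>R e \<theta>) / b - - (sin \<theta>)\<^sup>2 * \<phi> (\<rho>1 \<theta> *\<^sub>R e \<theta>) / a
      = - (sin \<theta>)\<^sup>2 * (\<phi> (\<rho>2 \<theta> *\<^sub>R e \<theta>) * a - \<phi> (\<rho>1 \<theta> *\<^sub>R e \<theta>) * b) / (a * b)"
      using ab by (simp add: field_simps)
    \<comment> \<open>The products of the two values of \<open>\<phi>\<close> cancel, which leaves
      the plain difference.\<close>
    also have "\<phi> (\<rho>2 \<theta> *\<^sub>R e \<theta>) * a - \<phi> (\<rho>1 \<theta> *\<^sub>R e \<theta>) * b = \<delta> \<theta>"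
      by (simp add: a_def b_def \<delta>_def algebra_simps)
    finally have "- (sin \<theta>)\<^sup>2 * \<phi> (\<rho>2 \<theta> *\<^sub>R e \<theta>) / b - - (sin \<theta>)\<^sup>2 * \<phi> (\<rho>1 \<theta> *\<^sub>R e \<theta>) / a
      = - (q \<theta> * \<delta> \<theta>)"
      by (simp add: q_def a_def b_def)
    then show ?thesis
      using DERIV_diff[OF deriv2[of \<theta>] deriv1[of \<theta>]]
      by (simp add: u_def[abs_def] a_def b_def)
  qed
  have \<delta>_sign: "0 \<le> \<sigma> * (u \<theta> * \<delta> \<theta>)" for \<theta>
  proof (cases "\<rho>1 \<theta> \<le> \<rho>2 \<theta>")
    case True
    then have "0 \<le> u \<theta>" "0 \<le> \<sigma> * \<delta> \<theta>"
      using \<phi>_radial_mono[OF in2 pos1 True] pos1[of \<theta>] pos2[of \<theta>]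
      by (simp_all add: u_def \<delta>_def right_diff_distrib)
    then show ?thesis using mult_nonneg_nonneg by (metis mult.left_commute)
  next
    case False
    then have "u \<theta> \<le> 0" "\<sigma> * \<delta> \<theta> \<le> 0"
      using \<phi>_radial_mono[OF in1 pos2, of \<theta> "\<rho>1 \<theta>"] pos1[of \<theta>] pos2[of \<theta>]
      by (simp_all add: u_def \<delta>_def right_diff_distrib)
    then show ?thesis using mult_nonpos_nonpos by (metis mult.left_commute)
  qed

  \<comment> \<open>The factor \<open>- \<sigma>\<close> makes the function nondecreasing for either
    sign of \<open>\<nu>\<close>.\<close>
  have usq_derivative: "((\<lambda>\<theta>. - \<sigma> * (u \<theta>)\<^sup>2) has_real_derivative 2 * q \<theta> * (\<sigma> * (u \<theta> * \<delta> \<theta>))) (at \<theta>)" for \<theta>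
    by (rule derivative_eq_intros u_derivative refl)+ simp
  have usq_const: "(u \<theta>)\<^sup>2 = (u \<theta>')\<^sup>2" for \<theta> \<theta>'
  proof -
    \<comment> \<open>a common period of both graphs\<close>
    define S where "S = of_nat k1 * (of_nat k2 * (2 * pi))"
    have "\<rho>1 (\<theta> + S) = \<rho>1 \<theta>" "\<rho>2 (\<theta> + S) = \<rho>2 \<theta>" for \<theta>
      using periodic_add_of_nat_mult[of \<rho>1 "of_nat k1 * (2 * pi)" \<theta> k2, OF per1]
        periodic_add_of_nat_mult[of \<rho>2 "of_nat k2 * (2 * pi)" \<theta> k1, OF per2]
      by (simp_all add: S_def mult.left_commute)
    then have periodic: "- \<sigma> * (u (\<theta> + S))\<^sup>2 = - \<sigma> * (u \<theta>)\<^sup>2" for \<theta>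
      by (simp add: u_def)
    have "- \<sigma> * (u \<theta>)\<^sup>2 = - \<sigma> * (u \<theta>')\<^sup>2"
    proof (rule mono_periodic_imp_constant[where T = S and f = "\<lambda>\<theta>. - \<sigma> * (u \<theta>)\<^sup>2"])
      show "S > 0" using k1 k2 by (simp add: S_def)
      show "- \<sigma> * (u s)\<^sup>2 \<le> - \<sigma> * (u t)\<^sup>2" if "s \<le> t" for s t
        by (rule DERIV_nonneg_imp_nondecreasing[OF that])
           (use usq_derivative q_nonneg \<delta>_sign in \<open>metis mult_nonneg_nonneg zero_le_numeral\<close>)
    qed (rule periodic)
    then show ?thesis using sign_cases by auto
  qed
  show ?thesis
  proof (cases "u 0 = 0")
    case True
    then have "\<rho>1 = \<rho>2"
      using usq_const[of _ 0] pos1 pos2 by (simp add: u_def fun_eq_iff)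
    then show ?thesis by (simp add: graph1 graph2)
  next
    case False
    have q\<delta>: "q \<theta> * \<delta> \<theta> = 0" for \<theta>
    proof -
      have "(\<lambda>\<theta>. - \<sigma> * (u \<theta>)\<^sup>2) = (\<lambda>\<theta>. - \<sigma> * (u 0)\<^sup>2)" using usq_const by metis
      then have "2 * q \<theta> * (\<sigma> * (u \<theta> * \<delta> \<theta>)) = 0"
        using usq_derivative[of \<theta>] DERIV_const DERIV_unique by metis
      moreover have "u \<theta> \<noteq> 0" using usq_const[of \<theta> 0] False by auto
      ultimately show ?thesis using sign_cases by auto
    qed
    then have "(u has_real_derivative 0) (at \<theta>)" for \<theta>
      using u_derivative[of \<theta>] unfolding q\<delta> by simp
    \<comment> \<open>Constancy of \<open>u\<close> itself, not only of its square, shows that the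
      same cycle is the inner one at every angle.\<close>
    then have u_const: "u \<theta> = u 0" for \<theta> using DERIV_isconst_all by blast
    have eq: "\<phi> (\<rho>2 \<theta> *\<^sub>R e \<theta>) = \<phi> (\<rho>1 \<theta> *\<^sub>R e \<theta>)" if "sin \<theta> \<noteq> 0" for \<theta>
      using q\<delta>[of \<theta>] that w1[of \<theta>] w2[of \<theta>] by (auto simp: q_def \<delta>_def)
    consider "0 < u 0" | "u 0 < 0" using False by linarith
    then have False
    proof cases
      case 1
      then have "0 < u \<theta>" for \<theta> using u_const[of \<theta>] by simp
      then have "\<rho>1 \<theta> < \<rho>2 \<theta>" for \<theta>
        using pos1 pos2 by (simp add: u_def)
      then show False
        using no_radial_equality[OF assms(1) graph1[unfolded e_def]] pos1 in2 eq
        unfolding e_def by blast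
    next
      case 2
      then have "u \<theta> < 0" for \<theta> using u_const[of \<theta>] by simp
      then have "\<rho>2 \<theta> < \<rho>1 \<theta>" for \<theta>
        using pos1 pos2 by (simp add: u_def)
      then show False
        using no_radial_equality[OF assms(2) graph2[unfolded e_def]] pos2 in1 eq
        unfolding e_def by metis
    qed
    then show ?thesis ..
  qed
qed

end

theorem theorem1:
  fixes \<Omega> :: "(real \<times> real) set"
    and \<phi> \<nu> P Q :: "real \<times> real \<Rightarrow> real"
  defines "\<nu> \<equiv> \<lambda>(x, y). x * partial_x \<phi> (x, y) + y * partial_y \<phi> (x, y)"
    and "P \<equiv> \<lambda>(x, y). y"
    and "Q \<equiv> \<lambda>(x, y). - x - y * \<phi> (x, y)"
  assumes "open \<Omega>"
    and "(0, 0) \<in> \<Omega>"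
    and "\<forall>p\<in>\<Omega>. closed_segment (0, 0) p \<subseteq> \<Omega>"
    and "C1_on \<phi> \<Omega>"
    and "does_not_change_sign_on \<nu> \<Omega>"
    and "\<not> (\<exists>S. nontrivial_positive_semi_orbit P Q \<Omega> S \<and> S \<subseteq> {p \<in> \<Omega>. \<nu> p = 0})"
  shows "(\<forall>C C'. limit_cycle P Q \<Omega> C \<and> limit_cycle P Q \<Omega> C' \<longrightarrow> C = C') \<and>
         (\<forall>C. limit_cycle P Q \<Omega> C \<longrightarrow> hyperbolic_cycle P Q \<Omega> C)"
proof -
  have P: "P = snd" and Q: "Q = (\<lambda>p. - fst p - snd p * \<phi> p)"
    and \<nu>: "\<nu> = (\<lambda>p. fst p * partial_x \<phi> p + snd p * partial_y \<phi> p)"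
    by (auto simp: P_def Q_def \<nu>_def fun_eq_iff)
  obtain \<sigma> :: real where \<sigma>: "\<sigma> = 1 \<or> \<sigma> = - 1" "\<And>p. p \<in> \<Omega> \<Longrightarrow> 0 \<le> \<sigma> * \<nu> p"
  proof -
    consider "\<forall>p\<in>\<Omega>. \<nu> p \<ge> 0" | "\<forall>p\<in>\<Omega>. \<nu> p \<le> 0"
      using assms(8) by (auto simp: does_not_change_sign_on_def)
    then show thesis
      by cases (use that[of 1] that[of "- 1"] in auto)
  qed
  interpret radially_monotone \<Omega> \<phi> \<sigma>
    using assms(4,6,7) \<sigma> by unfold_locales (auto simp: \<nu>)
  have \<nu>': "\<nu> = local.\<nu>" by (simp add: \<nu> local.\<nu>_def fun_eq_iff)
  have sol: "cycle_solution \<Omega> \<phi> \<sigma> T \<gamma>"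
    if "periodic_solution P Q \<Omega> T \<gamma>" "\<not> \<gamma> constant_on UNIV" for T \<gamma>
    using that assms(9) unfolding P Q \<nu>' by unfold_locales auto
  have unique: "C = C'" if "cycle P Q \<Omega> C" "cycle P Q \<Omega> C'" for C C'
    using that sol cycles_coincide unfolding cycle_def by metis
  have "hyperbolic_cycle P Q \<Omega> C" if C: "cycle P Q \<Omega> C" for C
    unfolding hyperbolic_cycle_def
  proof (intro conjI allI impI C)
    fix T \<gamma>
    assume \<gamma>: "periodic_solution P Q \<Omega> T \<gamma> \<and> range \<gamma> = C"
    obtain \<gamma>0 :: "real \<Rightarrow> real \<times> real" where "\<not> \<gamma>0 constant_on UNIV" "C = range \<gamma>0"
      using C unfolding cycle_def by auto
    \<comment> \<open>Whether a parametrization is constant depends only on its range, which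
      \<open>\<gamma>\<close> shares with \<open>\<gamma>0\<close>.\<close>
    then have "\<not> \<gamma> constant_on UNIV"
      using \<gamma> by (metis constant_on_def rangeE rangeI UNIV_I)
    then interpret cycle_solution \<Omega> \<phi> \<sigma> T \<gamma> using sol \<gamma> by blast
    show "integral {0..T} (\<lambda>t. partial_x P (\<gamma> t) + partial_y Q (\<gamma> t)) \<noteq> 0"
      unfolding P Q by (rule divergence_integral_nonzero)
  qed
  with unique show ?thesis unfolding limit_cycle_def by blast
qed

end
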